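(* Let $\alpha\in\mathbb{R}$ and $\beta\ge 1$, and consider the boundary value problem $$u''(x)+\frac{\beta}{x}u'(x)=f(x,u(x)),\quad 0<x\le 1,\qquad u'(0)=0,\quad u(1)=\alpha .$$ Suppose that $f$ is continuous and that there exist constants $M>0$, $L\ge 0$ such that $|f(x,u)|\le M$ and $|f(x,u_2)-f(x,u_1)|\le L|u_2-u_1|$ for all $(x,u),(x,u_1),(x,u_2)\in\mathcal{D}_M$, where $$\mathcal{D}_M=\Big\{(x,u)\ :\ 0\le x\le 1,\ |u|\le |\alpha|+\frac{M}{2(\beta+1)}\Big\},$$ and that $q=\dfrac{L}{2(\beta+1)}<1$. Define sequences $(\varphi_k)_{k\ge0}$, $(u_k)_{k\ge 0}$ of functions on $[0,1]$ by $$\varphi_0(x)=f(x,0),\qquad u_k(x)=\alpha+\int_0^1 t^\beta G_0(x,t)\varphi_k(t)\,dt,\qquad \varphi_{k+1}(x)=f(x,u_k(x)),\quad k\ge 0 .$$ Then $u_k$ converges uniformly to the solution $u$ of the boundary value problem. Moreover, the convergence is geometric, with the estimates $$\|u_k-u\|\le\frac{1}{2(\beta+1)}p_k,\qquad \|u_k'-u'\|\le\frac{1}{\beta+1}p_k,\qquad\text{where } p_k=\frac{q^k}{1-q}\|\varphi_1-\varphi_0\| ,$$ for all $k\ge 0$.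
   Context: $\|\cdot\|$ denotes the uniform (maximum) norm on $C[0,1]$. The function $f=f(x,u)$ is a real-valued function of $x\in[0,1]$ and $u\in\mathbb{R}$. A solution is a function that is continuously differentiable on $[0,1]$, twice differentiable on $(0,1]$, and satisfies the differential equation on $(0,1]$ and the boundary conditions; under the stated hypotheses the paper's existence theorem asserts that there is a unique solution $u$, satisfying $\|u\|\le|\alpha|+\frac{M}{2(\beta+1)}$ and $\|u'\|\le \frac{M}{\beta+1}$, and this is the $u$ in the claim. The Green function $G_0$ is defined as follows. For $\beta=1$: $G_0(x,t)=\ln t$ if $0<x\le t\le 1$, and $G_0(x,t)=\ln x$ if $0<t\le x\le 1$. For $\beta>1$: $G_0(x,t)=\frac{t^{1-\beta}-1}{1-\beta}$ if $0<x\le t\le1$, and $G_0(x,t)=\frac{x^{1-\beta}-1}{1-\beta}$ if $0<t\le x\le 1$. At $x=0$ the first branch is used: $G_0(0,t)=\ln t$ for $\beta=1$ and $G_0(0,t)=\frac{t^{1-\beta}-1}{1-\beta}$ for $\beta>1$, $0<t\le 1$. *)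

theory Defs
  imports "HOL-Analysis.Analysis"
begin

text \<open>The uniform norm on \<open>C[0,1]\<close>; only meaningful for functions bounded on \<open>[0,1]\<close>.\<close>

definition sup_norm :: "(real \<Rightarrow> real) \<Rightarrow> real" where
  "sup_norm g = (SUP x\<in>{0..1}. \<bar>g x\<bar>)"

text \<open>The derivative of a function on \<open>[0,1]\<close>, one-sided at the endpoints; the values of the
  function outside \<open>[0,1]\<close> play no role.\<close>

definition deriv01 :: "(real \<Rightarrow> real) \<Rightarrow> real \<Rightarrow> real" where
  "deriv01 g x = vector_derivative g (at x within {0..1})"

definition C1_on_01 :: "(real \<Rightarrow> real) \<Rightarrow> bool" where
  "C1_on_01 g \<longleftrightarrow> g differentiable_on {0..1} \<and> continuous_on {0..1} (deriv01 g)"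

definition bvp_solution ::
    "real \<Rightarrow> real \<Rightarrow> (real \<Rightarrow> real \<Rightarrow> real) \<Rightarrow> (real \<Rightarrow> real) \<Rightarrow> bool" where
  "bvp_solution \<alpha> \<beta> f u \<longleftrightarrow>
     C1_on_01 u \<and>
     (\<forall>x\<in>{0<..1}. deriv01 u differentiable (at x within {0..1}) \<and>
        deriv01 (deriv01 u) x + \<beta> / x * deriv01 u x = f x (u x)) \<and>
     deriv01 u 0 = 0 \<and> u 1 = \<alpha>"

definition dom_D :: "real \<Rightarrow> real \<Rightarrow> real \<Rightarrow> (real \<times> real) set" where
  "dom_D \<alpha> \<beta> M = {(x, u). 0 \<le> x \<and> x \<le> 1 \<and> \<bar>u\<bar> \<le> \<bar>\<alpha>\<bar> + M / (2 * (\<beta> + 1))}"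

text \<open>Only the values for \<open>0 \<le> x \<le> 1\<close> and \<open>0 < t \<le> 1\<close> are meaningful. The values at \<open>t = 0\<close> are
  immaterial: \<open>G0\<close> is only used multiplied by \<open>t powr \<beta>\<close>, which vanishes there.\<close>

definition G0 :: "real \<Rightarrow> real \<Rightarrow> real \<Rightarrow> real" where
  "G0 \<beta> x t =
     (if \<beta> = 1 then (if x \<le> t then ln t else ln x)
      else (if x \<le> t then (t powr (1 - \<beta>) - 1) / (1 - \<beta>)
            else (x powr (1 - \<beta>) - 1) / (1 - \<beta>)))"

end

theory Submission
  imports Defs "HOL-Real_Asymp.Real_Asymp"
begin

text \<open>
  Multiplied by \<open>x powr \<beta>\<close>, the differential equation reads \<open>(x powr \<beta> * u')' = x powr \<beta> * f x u\<close>.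
  The boundary condition at the singular point \<open>0\<close> fixes the constant of the first integration,
  so with \<open>\<phi> x = f x (u x)\<close> the problem is equivalent to \<open>u' = radial_flux \<beta> \<phi>\<close> and \<open>u 1 = \<alpha>\<close>, where
  \<open>radial_flux \<beta> \<phi> x\<close> is \<open>x powr (- \<beta>)\<close> times the integral of \<open>t powr \<beta> * \<phi> t\<close> over \<open>{0..x}\<close>
  (\<open>bvp_solutionI\<close>, \<open>bvp_solution_has_derivative\<close>). The Green function represents the second
  integration: \<open>\<alpha> + green_potential \<beta> \<phi>\<close> is the primitive of \<open>radial_flux \<beta> \<phi>\<close> with value \<open>\<alpha>\<close> at \<open>1\<close>
  (\<open>green_potential_has_derivative\<close>, \<open>green_potential_at_1\<close>).

  Both constants of the theorem come from this form. If two sources differ by at most \<open>C\<close>, then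
  their fluxes differ at \<open>x\<close> by at most \<open>C / (\<beta> + 1) * x\<close> (\<open>radial_flux_diff_bound\<close>), and integrating
  this from \<open>x\<close> to \<open>1\<close> shows that the potentials differ by at most \<open>C / (2 * (\<beta> + 1))\<close>
  (\<open>radial_potential_diff_bound\<close>). Composed with the Lipschitz bound for \<open>f\<close>, the second estimate
  makes \<open>\<phi> \<mapsto> f x (\<alpha> + green_potential \<beta> \<phi> x)\<close> a contraction with factor \<open>q\<close>; the bound \<open>M\<close> on \<open>f\<close>
  keeps all iterates inside \<open>dom_D \<alpha> \<beta> M\<close>. So the iteration takes place on the level of the sources:
  they converge to some \<open>\<Phi>\<close> with error at most \<open>p k\<close> (\<open>geometric_steps_limit\<close>), and applying the
  two difference bounds to \<open>\<phi> k\<close> and \<open>\<Phi>\<close> gives the two error estimates. Uniqueness is the same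
  contraction applied to the sources of two solutions.
\<close>

section \<open>Flux and Green potential of a radial source\<close>

text \<open>The primitive of \<open>t powr (- \<beta>)\<close> that vanishes at \<open>1\<close>; for \<open>\<beta> = n - 1\<close> it is the fundamental
  solution of the Laplacian in dimension \<open>n\<close>, up to scaling and an additive constant.\<close>

definition radial_profile :: "real \<Rightarrow> real \<Rightarrow> real" where
  "radial_profile \<beta> t = (if \<beta> = 1 then ln t else (t powr (1 - \<beta>) - 1) / (1 - \<beta>))"

text \<open>The derivative of a solution with source \<open>\<phi>\<close>, expressed by the mass of \<open>\<phi>\<close> in the ball of
  radius \<open>x\<close>, as in the divergence theorem. Since \<open>0 powr (- \<beta>) = 0\<close>, its value at \<open>0\<close> is the boundary value \<open>0\<close>.\<close>

definition radial_flux :: "real \<Rightarrow> (real \<Rightarrow> real) \<Rightarrow> real \<Rightarrow> real" where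
  "radial_flux \<beta> \<phi> x = x powr (- \<beta>) * integral {0..x} (\<lambda>t. t powr \<beta> * \<phi> t)"

definition green_potential :: "real \<Rightarrow> (real \<Rightarrow> real) \<Rightarrow> real \<Rightarrow> real" where
  "green_potential \<beta> \<phi> x = integral {0..1} (\<lambda>t. t powr \<beta> * G0 \<beta> x t * \<phi> t)"

lemma G0_eq_radial_profile: "G0 \<beta> x t = radial_profile \<beta> (max x t)"
  by (auto simp: G0_def radial_profile_def max_def)

lemma radial_profile_has_derivative:
  assumes "t > 0"
  shows "(radial_profile \<beta> has_real_derivative t powr (- \<beta>)) (at t)"
proof (cases "\<beta> = 1")
  case True
  then have "radial_profile \<beta> = ln" by (auto simp: radial_profile_def)
  then show ?thesis
    using assms True by (auto intro!: derivative_eq_intros simp: powr_minus field_simps)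
next
  case False
  then have eq: "radial_profile \<beta> = (\<lambda>t. (t powr (1 - \<beta>) - 1) / (1 - \<beta>))"
    by (auto simp: radial_profile_def)
  show ?thesis unfolding eq
    using assms False by (auto intro!: derivative_eq_intros)
qed

text \<open>The weight tames the singularity of the Green function at the origin: the product behaves
  like \<open>t * ln t\<close> for \<open>\<beta> = 1\<close>, and like a multiple of \<open>t\<close> for \<open>\<beta> > 1\<close>. Hence the integrals over the
  whole of \<open>{0..1}\<close> are integrals of continuous functions.\<close>

lemma continuous_on_weighted_profile:
  assumes "\<beta> \<ge> 1"
  shows "continuous_on {0..1} (\<lambda>t. t powr \<beta> * radial_profile \<beta> t)"
proof (cases "\<beta> = 1")
  case True
  have lim: "((\<lambda>t::real. t * ln t) \<longlongrightarrow> 0) (at_right 0)"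
    by real_asymp
  have "continuous_on {0..1} (\<lambda>t::real. t * ln t)"
  proof (clarsimp simp: continuous_on_eq_continuous_within)
    fix x :: real assume "0 \<le> x" "x \<le> 1"
    show "continuous (at x within {0..1}) (\<lambda>t. t * ln t)"
    proof (cases "x = 0")
      case True
      then show ?thesis using lim by (simp add: continuous_within at_within_Icc_at_right)
    next
      case False
      then show ?thesis by (intro continuous_intros) auto
    qed
  qed
  moreover have "t powr \<beta> * radial_profile \<beta> t = t * ln t" if "t \<in> {0..1}" for t
    using that True by (auto simp: radial_profile_def)
  ultimately show ?thesis by (subst continuous_on_cong[OF refl]) auto
next
  case False
  have "continuous_on {0..1} (\<lambda>t. (t - t powr \<beta>) / (1 - \<beta>))"
    using assms False by (intro continuous_intros continuous_on_powr') auto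
  moreover have "t powr \<beta> * radial_profile \<beta> t = (t - t powr \<beta>) / (1 - \<beta>)"
    if "t \<in> {0..1}" for t
  proof -
    have "t powr \<beta> * t powr (1 - \<beta>) = t"
      using that by (cases "t = 0") (auto simp flip: powr_add)
    then show ?thesis using False by (simp add: radial_profile_def right_diff_distrib)
  qed
  ultimately show ?thesis by (subst continuous_on_cong[OF refl]) auto
qed

lemma continuous_on_weight:
  fixes \<beta> :: real
  assumes "\<beta> \<ge> 1" "continuous_on S \<phi>" "S \<subseteq> {0..}"
  shows "continuous_on S (\<lambda>t. t powr \<beta> * \<phi> t)"
  using assms by (intro continuous_intros continuous_on_powr') auto

lemma weighted_mass_has_derivative:
  assumes "\<beta> \<ge> 1" "continuous_on {0..1} \<phi>" "x \<in> {0..1}"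
  shows "((\<lambda>x. integral {0..x} (\<lambda>t. t powr \<beta> * \<phi> t)) has_real_derivative x powr \<beta> * \<phi> x)
           (at x within {0..1})"
  using assms continuous_on_weight by (intro integral_has_real_derivative) auto

text \<open>The integral of \<open>C * t powr \<beta>\<close> over \<open>{0..x}\<close> is \<open>C * x powr (\<beta> + 1) / (\<beta> + 1)\<close>, and the prefactor
  of the flux reduces the power to the first. The factor \<open>x\<close> is worth keeping: it is
  responsible both for the continuity of the flux at \<open>0\<close> and for the factor \<open>2\<close> in the bound for
  potentials.\<close>

lemma radial_flux_diff_bound:
  assumes beta: "\<beta> \<ge> 1" and cont: "continuous_on {0..1} \<phi>" "continuous_on {0..1} \<psi>"
    and bound: "\<And>t. t \<in> {0..1} \<Longrightarrow> \<bar>\<phi> t - \<psi> t\<bar> \<le> C"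
    and x: "x \<in> {0..1}"
  shows "\<bar>radial_flux \<beta> \<phi> x - radial_flux \<beta> \<psi> x\<bar> \<le> C / (\<beta> + 1) * x"
proof (cases "x = 0")
  case True
  then show ?thesis by (simp add: radial_flux_def)
next
  case False
  then have x0: "x > 0" using x by auto
  have sub: "{0..x} \<subseteq> {0..1}" using x by auto
  have int: "(\<lambda>t. t powr \<beta> * \<eta> t) integrable_on {0..x}" if "continuous_on {0..1} \<eta>" for \<eta>
    using continuous_on_weight[OF beta continuous_on_subset[OF that sub]]
    by (intro integrable_continuous_real) auto
  have pw: "((\<lambda>t. C * t powr \<beta>) has_integral C * (x powr (\<beta> + 1) / (\<beta> + 1))) {0..x}"
    using beta x0 by (intro has_integral_mult_right has_integral_powr_from_0) auto
  have "integral {0..x} (\<lambda>t. t powr \<beta> * \<phi> t) - integral {0..x} (\<lambda>t. t powr \<beta> * \<psi> t)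
      = integral {0..x} (\<lambda>t. t powr \<beta> * \<phi> t - t powr \<beta> * \<psi> t)"
    by (rule Henstock_Kurzweil_Integration.integral_diff[symmetric]) (intro int cont)+
  also have "\<bar>\<dots>\<bar> \<le> integral {0..x} (\<lambda>t. C * t powr \<beta>)"
    unfolding real_norm_def[symmetric]
  proof (rule Henstock_Kurzweil_Integration.integral_norm_bound_integral)
    show "(\<lambda>t. t powr \<beta> * \<phi> t - t powr \<beta> * \<psi> t) integrable_on {0..x}"
      by (intro integrable_diff int cont)
    show "(\<lambda>t. C * t powr \<beta>) integrable_on {0..x}" using pw by blast
    fix t assume "t \<in> {0..x}"
    then have "t powr \<beta> * \<bar>\<phi> t - \<psi> t\<bar> \<le> t powr \<beta> * C"
      using bound[of t] sub by (intro mult_left_mono) auto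
    moreover have "t powr \<beta> * \<phi> t - t powr \<beta> * \<psi> t = t powr \<beta> * (\<phi> t - \<psi> t)"
      by (rule right_diff_distrib[symmetric])
    ultimately show "norm (t powr \<beta> * \<phi> t - t powr \<beta> * \<psi> t) \<le> C * t powr \<beta>"
      by (simp add: abs_mult mult.commute)
  qed
  also have "\<dots> = C * (x powr (\<beta> + 1) / (\<beta> + 1))" using pw by (rule integral_unique)
  finally have "x powr (- \<beta>) * \<bar>integral {0..x} (\<lambda>t. t powr \<beta> * \<phi> t)
                     - integral {0..x} (\<lambda>t. t powr \<beta> * \<psi> t)\<bar>
      \<le> x powr (- \<beta>) * (C * (x powr (\<beta> + 1) / (\<beta> + 1)))"
    by (intro mult_left_mono) auto
  also have "\<dots> = C / (\<beta> + 1) * (x powr (- \<beta>) * x powr (\<beta> + 1))" by simp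
  also have "x powr (- \<beta>) * x powr (\<beta> + 1) = x" using x0 by (simp flip: powr_add)
  finally show ?thesis
    unfolding radial_flux_def right_diff_distrib[symmetric] by (simp add: abs_mult)
qed

lemma radial_flux_bound:
  assumes "\<beta> \<ge> 1" "continuous_on {0..1} \<phi>"
    and "\<And>t. t \<in> {0..1} \<Longrightarrow> \<bar>\<phi> t\<bar> \<le> C" and "x \<in> {0..1}"
  shows "\<bar>radial_flux \<beta> \<phi> x\<bar> \<le> C / (\<beta> + 1) * x"
  using radial_flux_diff_bound[of \<beta> \<phi> "\<lambda>_. 0" C x] assms by (simp add: radial_flux_def)

text \<open>Differentiating the product gives the differential equation for the flux, away from the origin.\<close>

lemma radial_flux_has_derivative:
  assumes "\<beta> \<ge> 1" "continuous_on {0..1} \<phi>" "x \<in> {0<..1}"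
  shows "(radial_flux \<beta> \<phi> has_real_derivative \<phi> x - \<beta> / x * radial_flux \<beta> \<phi> x)
           (at x within {0..1})"
proof -
  have "((\<lambda>x. x powr (- \<beta>)) has_real_derivative - \<beta> * x powr (- \<beta> - 1)) (at x within {0..1})"
    using assms by (intro has_field_derivative_at_within[OF has_real_derivative_powr]) auto
  then have "(radial_flux \<beta> \<phi> has_real_derivative
      x powr (- \<beta>) * (x powr \<beta> * \<phi> x)
      + - \<beta> * x powr (- \<beta> - 1) * integral {0..x} (\<lambda>t. t powr \<beta> * \<phi> t)) (at x within {0..1})"
    unfolding radial_flux_def[abs_def]
    using assms by (intro DERIV_mult' weighted_mass_has_derivative) auto
  moreover have "x powr (- \<beta>) * (x powr \<beta> * \<phi> x) = \<phi> x"
    using assms by (simp add: powr_minus)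
  moreover have "x powr (- \<beta> - 1) = x powr (- \<beta>) / x"
    using assms by (simp add: powr_diff)
  ultimately show ?thesis by (simp add: radial_flux_def mult.assoc)
qed

lemma continuous_on_radial_flux:
  assumes beta: "\<beta> \<ge> 1" and cont: "continuous_on {0..1} \<phi>"
  shows "continuous_on {0..1} (radial_flux \<beta> \<phi>)"
  unfolding continuous_on_eq_continuous_within
proof
  fix x :: real assume x: "x \<in> {0..1}"
  show "continuous (at x within {0..1}) (radial_flux \<beta> \<phi>)"
  proof (cases "x = 0")
    case False
    with x show ?thesis
      using radial_flux_has_derivative[OF beta cont, of x] by (auto intro: DERIV_continuous)
  next
    case True
    obtain C where C: "\<And>t. t \<in> {0..1} \<Longrightarrow> \<bar>\<phi> t\<bar> \<le> C"
      using compact_imp_bounded[OF compact_continuous_image[OF cont compact_Icc]]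
      unfolding bounded_iff real_norm_def by blast
    have "((\<lambda>x. C / (\<beta> + 1) * x) \<longlongrightarrow> C / (\<beta> + 1) * 0) (at 0 within {0..1})"
      by (intro tendsto_intros)
    moreover have "\<forall>\<^sub>F x in at 0 within {0..1}. norm (radial_flux \<beta> \<phi> x) \<le> C / (\<beta> + 1) * x"
      using radial_flux_bound[OF beta cont C] by (auto simp: eventually_at_filter)
    ultimately have "(radial_flux \<beta> \<phi> \<longlongrightarrow> 0) (at 0 within {0..1})"
      by (intro Lim_null_comparison[of "radial_flux \<beta> \<phi>"]) auto
    with True show ?thesis by (simp add: continuous_within radial_flux_def)
  qed
qed

text \<open>The Green function depends on \<open>x\<close> and \<open>t\<close> through \<open>max x t\<close> only. Splitting the integral at \<open>t = x\<close>
  removes \<open>x\<close> from the integrands and leaves it in places where it can be differentiated.\<close>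

lemma green_potential_split:
  assumes beta: "\<beta> \<ge> 1" and cont: "continuous_on {0..1} \<phi>" and x: "x \<in> {0..1}"
  shows "green_potential \<beta> \<phi> x =
           radial_profile \<beta> x * integral {0..x} (\<lambda>t. t powr \<beta> * \<phi> t)
           + integral {x..1} (\<lambda>t. t powr \<beta> * radial_profile \<beta> t * \<phi> t)"
proof -
  let ?g = "\<lambda>t. t powr \<beta> * G0 \<beta> x t * \<phi> t"
  have "(\<lambda>t. t powr \<beta> * \<phi> t) integrable_on {0..x}"
    using x by (intro integrable_continuous_real continuous_on_weight beta
                  continuous_on_subset[OF cont]) auto
  then have "((\<lambda>t. radial_profile \<beta> x * (t powr \<beta> * \<phi> t)) has_integral
       radial_profile \<beta> x * integral {0..x} (\<lambda>t. t powr \<beta> * \<phi> t)) {0..x}"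
    by (intro has_integral_mult_right integrable_integral)
  then have left: "(?g has_integral
       radial_profile \<beta> x * integral {0..x} (\<lambda>t. t powr \<beta> * \<phi> t)) {0..x}"
    by (rule has_integral_eq[rotated]) (auto simp: G0_eq_radial_profile max_def)
  have "continuous_on {0..1} (\<lambda>t. t powr \<beta> * radial_profile \<beta> t * \<phi> t)"
    by (intro continuous_on_mult continuous_on_weighted_profile beta cont)
  then have "(\<lambda>t. t powr \<beta> * radial_profile \<beta> t * \<phi> t) integrable_on {x..1}"
    using x by (intro integrable_continuous_real) (auto elim: continuous_on_subset)
  then have "(?g has_integral integral {x..1} (\<lambda>t. t powr \<beta> * radial_profile \<beta> t * \<phi> t)) {x..1}"
    by (intro has_integral_eq[OF _ integrable_integral]) (auto simp: G0_eq_radial_profile max_def)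
  from has_integral_combine[OF _ _ left this] show ?thesis
    using x unfolding green_potential_def by (intro integral_unique) auto
qed

lemma green_potential_at_1:
  assumes "\<beta> \<ge> 1" "continuous_on {0..1} \<phi>"
  shows "green_potential \<beta> \<phi> 1 = 0"
  using green_potential_split[OF assms, of 1] by (simp add: radial_profile_def)

text \<open>At \<open>0\<close> the profile is singular, but its product with the mass integral equals the weighted profile
  times the flux, two functions that are continuous on all of \<open>{0..1}\<close>.\<close>

lemma continuous_on_green_potential:
  assumes beta: "\<beta> \<ge> 1" and cont: "continuous_on {0..1} \<phi>"
  shows "continuous_on {0..1} (green_potential \<beta> \<phi>)"
proof -
  let ?K = "\<lambda>t. t powr \<beta> * radial_profile \<beta> t * \<phi> t"
  have K: "continuous_on {0..1} ?K"
    by (intro continuous_on_mult continuous_on_weighted_profile beta cont)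
  have "continuous_on {0..1} (\<lambda>x. integral {x..1} ?K)"
    by (rule DERIV_continuous_on) (rule integral_has_real_derivative'[OF K])
  then have "continuous_on {0..1}
      (\<lambda>x. x powr \<beta> * radial_profile \<beta> x * radial_flux \<beta> \<phi> x + integral {x..1} ?K)"
    by (intro continuous_on_add continuous_on_mult continuous_on_weighted_profile
          continuous_on_radial_flux beta cont)
  moreover have "green_potential \<beta> \<phi> x =
      x powr \<beta> * radial_profile \<beta> x * radial_flux \<beta> \<phi> x + integral {x..1} ?K"
    if "x \<in> {0..1}" for x
    using green_potential_split[OF beta cont that] that
    by (cases "x = 0") (auto simp: radial_flux_def powr_minus)
  ultimately show ?thesis by (subst continuous_on_cong[OF refl]) auto
qed

text \<open>In the interior, the derivative of the split form is the flux, because the two terms that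
  contain \<open>\<phi> y\<close> cancel. At \<open>0\<close> the profile cannot be differentiated; instead, continuity up to the
  endpoints makes the potential an integral of the flux, and the flux is continuous there.\<close>

lemma green_potential_has_derivative:
  assumes beta: "\<beta> \<ge> 1" and cont: "continuous_on {0..1} \<phi>" and x: "x \<in> {0..1}"
  shows "(green_potential \<beta> \<phi> has_real_derivative radial_flux \<beta> \<phi> x) (at x within {0..1})"
proof -
  let ?K = "\<lambda>t. t powr \<beta> * radial_profile \<beta> t * \<phi> t"
  let ?P = "\<lambda>x. integral {0..x} (\<lambda>t. t powr \<beta> * \<phi> t)"
  have K: "continuous_on {0..1} ?K"
    by (intro continuous_on_mult continuous_on_weighted_profile beta cont)
  have interior: "(green_potential \<beta> \<phi> has_real_derivative radial_flux \<beta> \<phi> y) (at y)"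
    if y: "y \<in> {0<..<1}" for y
  proof -
    have "((\<lambda>x. radial_profile \<beta> x * ?P x + integral {x..1} ?K) has_real_derivative
        (radial_profile \<beta> y * (y powr \<beta> * \<phi> y) + y powr (- \<beta>) * ?P y) + - ?K y)
        (at y within {0..1})"
      using y by (intro DERIV_add DERIV_mult' integral_has_real_derivative' K
                     weighted_mass_has_derivative beta cont
                     has_field_derivative_at_within[OF radial_profile_has_derivative]) auto
    then have "((\<lambda>x. radial_profile \<beta> x * ?P x + integral {x..1} ?K) has_real_derivative
        radial_flux \<beta> \<phi> y) (at y within {0..1})"
      by (simp add: radial_flux_def)
    then have "(green_potential \<beta> \<phi> has_real_derivative radial_flux \<beta> \<phi> y) (at y within {0..1})"
      using y by (elim has_field_derivative_transform_within[where d = 1])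
                 (auto simp: green_potential_split[OF beta cont])
    with y show ?thesis by (simp add: at_within_Icc_at)
  qed
  have FTC: "green_potential \<beta> \<phi> y = green_potential \<beta> \<phi> 0 + integral {0..y} (radial_flux \<beta> \<phi>)"
    if y: "y \<in> {0..1}" for y
  proof -
    have "(radial_flux \<beta> \<phi> has_integral green_potential \<beta> \<phi> y - green_potential \<beta> \<phi> 0) {0..y}"
      using y interior
      by (intro fundamental_theorem_of_calculus_interior
            continuous_on_subset[OF continuous_on_green_potential[OF beta cont]])
         (auto simp: has_real_derivative_iff_has_vector_derivative)
    then show ?thesis by (simp add: integral_unique)
  qed
  have "((\<lambda>y. green_potential \<beta> \<phi> 0 + integral {0..y} (radial_flux \<beta> \<phi>)) has_real_derivative
      0 + radial_flux \<beta> \<phi> x) (at x within {0..1})"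
    by (intro DERIV_add DERIV_const integral_has_real_derivative
          continuous_on_radial_flux beta cont x)
  then have "((\<lambda>y. green_potential \<beta> \<phi> 0 + integral {0..y} (radial_flux \<beta> \<phi>)) has_real_derivative
      radial_flux \<beta> \<phi> x) (at x within {0..1})" by simp
  then show ?thesis
    by (rule has_field_derivative_transform_within[where d = 1]) (use x FTC[symmetric] in auto)
qed

section \<open>The uniform norm and derivatives on the unit interval\<close>

lemma sup_norm_le:
  assumes "\<And>x. x \<in> {0..1} \<Longrightarrow> \<bar>g x\<bar> \<le> C"
  shows "sup_norm g \<le> C"
  unfolding sup_norm_def using assms by (intro cSUP_least) auto

lemma abs_le_sup_norm:
  assumes "continuous_on {0..1} g" "x \<in> {0..1}"
  shows "\<bar>g x\<bar> \<le> sup_norm g"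
proof -
  have "compact ((\<lambda>x. \<bar>g x\<bar>) ` {0..1})"
    using assms(1) by (intro compact_continuous_image continuous_intros compact_Icc)
  then have "bdd_above ((\<lambda>x. \<bar>g x\<bar>) ` {0..1})"
    by (intro bounded_imp_bdd_above compact_imp_bounded)
  with assms(2) show ?thesis unfolding sup_norm_def by (rule cSUP_upper)
qed

lemma deriv01_eqI:
  assumes "(g has_real_derivative d) (at x within {0..1})" "x \<in> {0..1}"
  shows "deriv01 g x = d"
  using assms unfolding deriv01_def
  by (intro vector_derivative_within_closed_interval)
     (auto simp: has_real_derivative_iff_has_vector_derivative)

lemma has_derivative_deriv01:
  assumes "g differentiable (at x within {0..1})"
  shows "(g has_real_derivative deriv01 g x) (at x within {0..1})"
  using assms unfolding deriv01_def
  by (simp add: has_real_derivative_iff_has_vector_derivative vector_derivative_works)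

lemma C1_on_01I:
  assumes "\<And>x. x \<in> {0..1} \<Longrightarrow> (g has_real_derivative g' x) (at x within {0..1})"
    and "continuous_on {0..1} g'"
  shows "C1_on_01 g"
  unfolding C1_on_01_def
proof
  show "g differentiable_on {0..1}"
    using assms(1) real_differentiable_def unfolding differentiable_on_def by blast
  have "deriv01 g x = g' x" if "x \<in> {0..1}" for x
    using deriv01_eqI[OF assms(1)] that by blast
  with assms(2) show "continuous_on {0..1} (deriv01 g)"
    by (subst continuous_on_cong[OF refl]) auto
qed

section \<open>The boundary value problem as an integral equation\<close>

lemma bvp_solutionI:
  assumes beta: "\<beta> \<ge> 1" and cont: "continuous_on {0..1} \<phi>"
    and deriv: "\<And>x. x \<in> {0..1} \<Longrightarrow> (u has_real_derivative radial_flux \<beta> \<phi> x) (at x within {0..1})"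
    and "u 1 = \<alpha>" and \<phi>: "\<And>x. x \<in> {0..1} \<Longrightarrow> \<phi> x = f x (u x)"
  shows "bvp_solution \<alpha> \<beta> f u"
proof -
  have d1: "deriv01 u x = radial_flux \<beta> \<phi> x" if "x \<in> {0..1}" for x
    using deriv01_eqI[OF deriv] that by blast
  have d2: "(deriv01 u has_real_derivative \<phi> x - \<beta> / x * radial_flux \<beta> \<phi> x) (at x within {0..1})"
    if "x \<in> {0<..1}" for x
    using that d1
    by (intro has_field_derivative_transform_within[OF radial_flux_has_derivative[OF beta cont],
          of x 1]) auto
  have "deriv01 u differentiable (at x within {0..1}) \<and>
        deriv01 (deriv01 u) x + \<beta> / x * deriv01 u x = f x (u x)" if x: "x \<in> {0<..1}" for x
    using d2[OF x] deriv01_eqI[OF d2[OF x]] d1[of x] \<phi>[of x] x real_differentiable_def by auto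
  moreover have "C1_on_01 u"
    using deriv continuous_on_radial_flux[OF beta cont] by (rule C1_on_01I)
  ultimately show ?thesis
    using d1[of 0] \<open>u 1 = \<alpha>\<close> by (auto simp: bvp_solution_def radial_flux_def)
qed

text \<open>The converse, on which uniqueness rests. The function \<open>t powr \<beta> * v' t\<close> vanishes at \<open>0\<close>, is continuous
  there because \<open>v\<close> is continuously differentiable, and has derivative \<open>t powr \<beta> * f t (v t)\<close> by the
  differential equation; so it is the integral of that derivative.\<close>

lemma bvp_solution_has_derivative:
  assumes beta: "\<beta> \<ge> 1" and sol: "bvp_solution \<alpha> \<beta> f v" and x: "x \<in> {0..1}"
  shows "(v has_real_derivative radial_flux \<beta> (\<lambda>t. f t (v t)) x) (at x within {0..1})"
proof -
  let ?w = "\<lambda>t. t powr \<beta> * deriv01 v t"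
  have v: "(v has_real_derivative deriv01 v x) (at x within {0..1})"
    using sol x by (auto simp: bvp_solution_def C1_on_01_def differentiable_on_def
                       intro: has_derivative_deriv01)
  have w': "(?w has_real_derivative t powr \<beta> * f t (v t)) (at t)" if t: "t \<in> {0<..<x}" for t
  proof -
    have t01: "t \<in> {0<..<1}" using t x by auto
    have "(deriv01 v has_real_derivative deriv01 (deriv01 v) t) (at t within {0..1})"
      using sol t01 by (intro has_derivative_deriv01) (auto simp: bvp_solution_def)
    moreover have "((\<lambda>t. t powr \<beta>) has_real_derivative \<beta> * t powr (\<beta> - 1)) (at t within {0..1})"
      using t by (intro has_field_derivative_at_within[OF has_real_derivative_powr]) auto
    ultimately have "(?w has_real_derivative
        t powr \<beta> * deriv01 (deriv01 v) t + \<beta> * t powr (\<beta> - 1) * deriv01 v t) (at t within {0..1})"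
      by (intro DERIV_mult')
    moreover have "t powr \<beta> * deriv01 (deriv01 v) t + \<beta> * t powr (\<beta> - 1) * deriv01 v t
        = t powr \<beta> * (deriv01 (deriv01 v) t + \<beta> / t * deriv01 v t)"
      using t by (simp add: powr_diff algebra_simps)
    moreover have "deriv01 (deriv01 v) t + \<beta> / t * deriv01 v t = f t (v t)"
      using sol t01 by (auto simp: bvp_solution_def)
    ultimately show ?thesis using t01 by (simp add: at_within_Icc_at)
  qed
  have "continuous_on {0..x} (deriv01 v)"
    using sol x by (auto simp: bvp_solution_def C1_on_01_def elim: continuous_on_subset)
  then have "continuous_on {0..x} ?w"
    using beta by (intro continuous_on_weight) auto
  then have "((\<lambda>t. t powr \<beta> * f t (v t)) has_integral ?w x - ?w 0) {0..x}"
    using x w' by (intro fundamental_theorem_of_calculus_interior)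
                  (auto simp: has_real_derivative_iff_has_vector_derivative)
  then have "integral {0..x} (\<lambda>t. t powr \<beta> * f t (v t)) = x powr \<beta> * deriv01 v x"
    by (simp add: integral_unique)
  then have "radial_flux \<beta> (\<lambda>t. f t (v t)) x = deriv01 v x"
    using sol x by (cases "x = 0") (auto simp: radial_flux_def powr_minus bvp_solution_def)
  with v show ?thesis by simp
qed

text \<open>A derivative bounded by \<open>c * x\<close> makes \<open>w x + c * x\<^sup>2 / 2\<close> nondecreasing, so that its value at \<open>1\<close>
  bounds it.\<close>

lemma upper_bound_of_linear_derivative_bound:
  fixes w :: "real \<Rightarrow> real"
  assumes deriv: "\<And>x. x \<in> {0..1} \<Longrightarrow> (w has_real_derivative w' x) (at x within {0..1})"
    and bound: "\<And>x. x \<in> {0..1} \<Longrightarrow> \<bar>w' x\<bar> \<le> c * x"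
    and "w 1 = 0" and x: "x \<in> {0..1}"
  shows "w x \<le> c / 2"
proof -
  have deriv': "((\<lambda>x. w x + c * x\<^sup>2 / 2) has_real_derivative w' y + c * y) (at y within {0..1})"
    if "y \<in> {0..1}" for y
    using that by (auto intro!: derivative_eq_intros deriv)
  have "w x + c * x\<^sup>2 / 2 \<le> w 1 + c * 1\<^sup>2 / 2"
  proof (rule DERIV_nonneg_imp_increasing_open[of x 1])
    show "\<exists>d. ((\<lambda>x. w x + c * x\<^sup>2 / 2) has_real_derivative d) (at y) \<and> 0 \<le> d"
      if "x < y" "y < 1" for y
      using deriv'[of y] bound[of y] that x by (auto simp: at_within_Icc_at abs_le_iff)
    show "continuous_on {x..1} (\<lambda>x. w x + c * x\<^sup>2 / 2)"
      using DERIV_continuous_on[OF deriv'] x by (auto elim: continuous_on_subset)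
  qed (use x in auto)
  moreover have "c * 0 \<le> c * x\<^sup>2" 
    using bound[of 1] by (intro mult_left_mono) auto
  ultimately show ?thesis using \<open>w 1 = 0\<close> by simp
qed

text \<open>The flux bound has the linear form needed for the previous lemma, with \<open>c = C / (\<beta> + 1)\<close>. Stated for
  arbitrary primitives of the two fluxes, it applies to the iterates and their limit, which are Green
  potentials, and also to a solution known only through its derivative.\<close>

lemma radial_potential_diff_bound:
  assumes beta: "\<beta> \<ge> 1" and cont: "continuous_on {0..1} \<phi>" "continuous_on {0..1} \<psi>"
    and u: "\<And>x. x \<in> {0..1} \<Longrightarrow> (u has_real_derivative radial_flux \<beta> \<phi> x) (at x within {0..1})"
    and v: "\<And>x. x \<in> {0..1} \<Longrightarrow> (v has_real_derivative radial_flux \<beta> \<psi> x) (at x within {0..1})"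
    and "u 1 = v 1"
    and bound: "\<And>t. t \<in> {0..1} \<Longrightarrow> \<bar>\<phi> t - \<psi> t\<bar> \<le> C"
    and x: "x \<in> {0..1}"
  shows "\<bar>u x - v x\<bar> \<le> C / (2 * (\<beta> + 1))"
proof -
  have "u x - v x \<le> C / (\<beta> + 1) / 2"
    using radial_flux_diff_bound[OF beta cont bound] u v \<open>u 1 = v 1\<close> x
    by (intro upper_bound_of_linear_derivative_bound[of "\<lambda>x. u x - v x"
                "\<lambda>x. radial_flux \<beta> \<phi> x - radial_flux \<beta> \<psi> x"] DERIV_diff) auto
  moreover have "v x - u x \<le> C / (\<beta> + 1) / 2"
    using radial_flux_diff_bound[OF beta cont bound] u v \<open>u 1 = v 1\<close> x
    by (intro upper_bound_of_linear_derivative_bound[of "\<lambda>x. v x - u x"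
                "\<lambda>x. radial_flux \<beta> \<psi> x - radial_flux \<beta> \<phi> x"] DERIV_diff)
       (auto simp: abs_minus_commute)
  moreover have "C / (\<beta> + 1) / 2 = C / (2 * (\<beta> + 1))" by (simp add: mult.commute)
  ultimately show ?thesis by (metis abs_le_iff minus_diff_eq)
qed

section \<open>Sequences with geometrically decreasing steps\<close>

text \<open>The steps from \<open>k\<close> to \<open>n\<close> sum to at most \<open>(q ^ k - q ^ n) / (1 - q) * d\<close>; let \<open>n\<close> tend to infinity.\<close>

lemma geometric_steps_limit:
  fixes \<phi> :: "nat \<Rightarrow> 'a \<Rightarrow> real"
  assumes q: "0 \<le> q" "q < 1"
    and step: "\<And>k x. x \<in> S \<Longrightarrow> \<bar>\<phi> (Suc k) x - \<phi> k x\<bar> \<le> q ^ k * d"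
  obtains g where "\<And>k x. x \<in> S \<Longrightarrow> \<bar>\<phi> k x - g x\<bar> \<le> q ^ k / (1 - q) * d"
proof
  fix k x assume x: "x \<in> S"
  have d: "d \<ge> 0" using step[OF x, of 0] by simp
  let ?s = "\<lambda>i. \<phi> (Suc i) x - \<phi> i x"
  have "summable ?s"
  proof (rule summable_comparison_test')
    show "summable (\<lambda>i. q ^ i * d)"
      using q by (intro summable_mult2 summable_geometric) auto
  qed (use step[OF x] in auto)
  then have "(\<lambda>n. \<Sum>i<n. ?s i) \<longlonglongrightarrow> suminf ?s" by (rule summable_LIMSEQ)
  then have "(\<lambda>n. \<phi> n x - \<phi> 0 x) \<longlonglongrightarrow> suminf ?s" 
    by (simp add: sum_lessThan_telescope[where f = "\<lambda>i. \<phi> i x"])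
  then have "convergent (\<lambda>n. \<phi> n x)"
    using convergent_diff_const_right_iff convergentI by blast
  then have lim: "(\<lambda>n. \<phi> n x) \<longlonglongrightarrow> lim (\<lambda>n. \<phi> n x)" by (simp add: convergent_LIMSEQ_iff)
  have tail: "\<bar>\<phi> k x - \<phi> n x\<bar> \<le> (q ^ k - q ^ n) / (1 - q) * d" if "n \<ge> k" for n
    using that
  proof (induction n rule: dec_induct)
    case (step n)
    have "\<bar>\<phi> k x - \<phi> (Suc n) x\<bar> \<le> (q ^ k - q ^ n) / (1 - q) * d + q ^ n * d"
      using step.IH assms(3)[OF x, of n] by linarith
    also have "\<dots> = (q ^ k - q ^ Suc n) / (1 - q) * d"
      using q by (simp add: field_simps)
    finally show ?case .
  qed simp
  have "(q ^ k - q ^ n) / (1 - q) * d \<le> q ^ k / (1 - q) * d" for n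
    using q d by (intro mult_right_mono divide_right_mono) auto
  then have "\<exists>N. \<forall>n\<ge>N. \<bar>\<phi> k x - \<phi> n x\<bar> \<le> q ^ k / (1 - q) * d"
    using tail order_trans by blast
  with lim show "\<bar>\<phi> k x - lim (\<lambda>n. \<phi> n x)\<bar> \<le> q ^ k / (1 - q) * d"
    by (intro LIMSEQ_le_const2[of "\<lambda>n. \<bar>\<phi> k x - \<phi> n x\<bar>"] tendsto_intros)
qed

lemma uniform_limit_geometric:
  fixes \<phi> :: "nat \<Rightarrow> 'a \<Rightarrow> real"
  assumes q: "0 \<le> q" "q < 1"
    and bound: "\<And>k x. x \<in> S \<Longrightarrow> \<bar>\<phi> k x - g x\<bar> \<le> c * q ^ k"
  shows "uniform_limit S \<phi> g sequentially"
proof (rule uniform_limitI)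
  fix e :: real assume "e > 0"
  have "(\<lambda>k. c * q ^ k) \<longlonglongrightarrow> c * 0"
    using q by (intro tendsto_intros LIMSEQ_power_zero) auto
  then have "\<forall>\<^sub>F k in sequentially. c * q ^ k < e"
    using \<open>e > 0\<close> by (intro order_tendstoD(2)[where y = "c * 0"]) auto
  then show "\<forall>\<^sub>F k in sequentially. \<forall>x\<in>S. dist (\<phi> k x) (g x) < e"
    by eventually_elim (auto simp: dist_real_def intro: le_less_trans[OF bound])
qed

section \<open>Convergence of the iteration\<close>

theorem theorem2p2:
  fixes \<alpha> \<beta> M L q :: real
    and f :: "real \<Rightarrow> real \<Rightarrow> real"
    and \<phi> us :: "nat \<Rightarrow> real \<Rightarrow> real"
    and p :: "nat \<Rightarrow> real"
  assumes beta: "\<beta> \<ge> 1"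
    and f_cont: "continuous_on ({0..1} \<times> UNIV) (\<lambda>(x, u). f x u)"
    and M_pos: "M > 0" and L_nonneg: "L \<ge> 0"
    and f_bound: "\<And>x u. (x, u) \<in> dom_D \<alpha> \<beta> M \<Longrightarrow> \<bar>f x u\<bar> \<le> M"
    and f_lipschitz: "\<And>x u1 u2. (x, u1) \<in> dom_D \<alpha> \<beta> M \<Longrightarrow> (x, u2) \<in> dom_D \<alpha> \<beta> M \<Longrightarrow>
           \<bar>f x u2 - f x u1\<bar> \<le> L * \<bar>u2 - u1\<bar>"
    and q_def: "q = L / (2 * (\<beta> + 1))" and q_less_1: "q < 1"
    and phi_0: "\<And>x. x \<in> {0..1} \<Longrightarrow> \<phi> 0 x = f x 0"
    and us_def: "\<And>k x. x \<in> {0..1} \<Longrightarrow>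
           us k x = \<alpha> + integral {0..1} (\<lambda>t. t powr \<beta> * G0 \<beta> x t * \<phi> k t)"
    and phi_Suc: "\<And>k x. x \<in> {0..1} \<Longrightarrow> \<phi> (Suc k) x = f x (us k x)"
    and p_def: "\<And>k. p k = q ^ k / (1 - q) * sup_norm (\<lambda>x. \<phi> 1 x - \<phi> 0 x)"
  shows "\<exists>u. bvp_solution \<alpha> \<beta> f u \<and>
           sup_norm u \<le> \<bar>\<alpha>\<bar> + M / (2 * (\<beta> + 1)) \<and>
           sup_norm (deriv01 u) \<le> M / (\<beta> + 1) \<and>
           (\<forall>v. bvp_solution \<alpha> \<beta> f v \<and> sup_norm v \<le> \<bar>\<alpha>\<bar> + M / (2 * (\<beta> + 1)) \<longrightarrow>
              (\<forall>x\<in>{0..1}. v x = u x)) \<and>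
           uniform_limit {0..1} us u sequentially \<and>
           (\<forall>k. C1_on_01 (us k) \<and>
              sup_norm (\<lambda>x. us k x - u x) \<le> 1 / (2 * (\<beta> + 1)) * p k \<and>
              sup_norm (\<lambda>x. deriv01 (us k) x - deriv01 u x) \<le> 1 / (\<beta> + 1) * p k)"
proof -
  let ?R = "\<bar>\<alpha>\<bar> + M / (2 * (\<beta> + 1))"
  let ?I = "{0..1::real}"
  have q0: "q \<ge> 0" and Lq: "L * (c / (2 * (\<beta> + 1))) = q * c" for c
    using beta L_nonneg by (auto simp: q_def)
  have f_comp: "continuous_on ?I (\<lambda>x. f x (v x))" if "continuous_on ?I v" for v
    using continuous_on_compose2[OF f_cont, of ?I "\<lambda>x. (x, v x)"] that
    by (auto simp: continuous_on_Pair)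

  have pot_deriv: "((\<lambda>x. \<alpha> + green_potential \<beta> \<eta> x) has_real_derivative radial_flux \<beta> \<eta> x)
      (at x within ?I)" if "continuous_on ?I \<eta>" "x \<in> ?I" for \<eta> x
    using green_potential_has_derivative[OF beta that] by (auto intro!: derivative_eq_intros)
  have pot_1: "\<alpha> + green_potential \<beta> \<eta> 1 = \<alpha>" if "continuous_on ?I \<eta>" for \<eta>
    using green_potential_at_1[OF beta that] by simp
  \<comment> \<open>A source bounded by \<open>M\<close> has a potential whose graph lies in \<open>dom_D \<alpha> \<beta> M\<close>: compare it with
    the constant \<open>\<alpha>\<close>, the potential of the zero source.\<close>
  have pot_bound: "\<bar>\<alpha> + green_potential \<beta> \<eta> x\<bar> \<le> ?R"
    if \<eta>: "continuous_on ?I \<eta>" "\<And>t. t \<in> ?I \<Longrightarrow> \<bar>\<eta> t\<bar> \<le> M" and x: "x \<in> ?I" for \<eta> x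
  proof -
    have "\<bar>(\<alpha> + green_potential \<beta> \<eta> x) - \<alpha>\<bar> \<le> M / (2 * (\<beta> + 1))"
      using \<eta> x pot_1
      by (intro radial_potential_diff_bound[OF beta \<eta>(1), where \<psi> = "\<lambda>_. 0" and v = "\<lambda>_. \<alpha>"]
            pot_deriv) (auto simp: radial_flux_def)
    then show ?thesis by linarith
  qed

  have us_pot: "us k x = \<alpha> + green_potential \<beta> (\<phi> k) x" if "x \<in> ?I" for k x
    using us_def[OF that] by (simp add: green_potential_def)
  have phi: "continuous_on ?I (\<phi> k) \<and> (\<forall>x\<in>?I. \<bar>\<phi> k x\<bar> \<le> M)" for k
  proof (induction k)
    case 0
    have "continuous_on ?I (\<phi> 0)"
      using f_comp[of "\<lambda>_. 0"] phi_0 by (subst continuous_on_cong[OF refl]) auto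
    moreover have "\<bar>\<phi> 0 x\<bar> \<le> M" if "x \<in> ?I" for x
      using that phi_0[OF that] f_bound[of x 0] M_pos beta by (auto simp: dom_D_def)
    ultimately show ?case by blast
  next
    case (Suc k)
    then have IH: "continuous_on ?I (\<phi> k)" "\<And>x. x \<in> ?I \<Longrightarrow> \<bar>\<phi> k x\<bar> \<le> M" by auto
    have eq: "\<phi> (Suc k) x = f x (\<alpha> + green_potential \<beta> (\<phi> k) x)" if "x \<in> ?I" for x
      using phi_Suc[OF that] us_pot[OF that] by simp
    have "continuous_on ?I (\<lambda>x. f x (\<alpha> + green_potential \<beta> (\<phi> k) x))"
      by (intro f_comp continuous_intros continuous_on_green_potential beta IH)
    then have "continuous_on ?I (\<phi> (Suc k))"
      using eq by (subst continuous_on_cong[OF refl]) auto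
    moreover have "\<bar>\<phi> (Suc k) x\<bar> \<le> M" if "x \<in> ?I" for x
      using that eq[OF that] pot_bound[OF IH that] f_bound by (auto simp: dom_D_def)
    ultimately show ?case by blast
  qed
  then have phi_cont: "continuous_on ?I (\<phi> k)" and phi_M: "x \<in> ?I \<Longrightarrow> \<bar>\<phi> k x\<bar> \<le> M" for k x
    by auto
  have us_deriv: "(us k has_real_derivative radial_flux \<beta> (\<phi> k) x) (at x within ?I)"
    if "x \<in> ?I" for k x
    using that by (intro has_field_derivative_transform_within[OF pot_deriv[OF phi_cont that],
                         of 1]) (auto simp: us_pot)
  have us_1: "us k 1 = \<alpha>" for k using us_pot[of 1] pot_1[OF phi_cont] by simp
  have us_R: "\<bar>us k x\<bar> \<le> ?R" if "x \<in> ?I" for k x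
    using pot_bound[OF phi_cont phi_M that] us_pot[OF that] by simp

  \<comment> \<open>One iteration multiplies the distance of consecutive sources by at most \<open>1 / (2 * (\<beta> + 1))\<close>,
    passing to the potentials, and then by at most \<open>L\<close>, passing through \<open>f\<close>.\<close>
  define d where "d = sup_norm (\<lambda>x. \<phi> 1 x - \<phi> 0 x)"
  have step: "\<bar>\<phi> (Suc k) x - \<phi> k x\<bar> \<le> q ^ k * d" if "x \<in> ?I" for k x
    using that
  proof (induction k arbitrary: x)
    case 0
    then show ?case
      using abs_le_sup_norm[of "\<lambda>x. \<phi> 1 x - \<phi> 0 x" x] phi_cont
      by (auto simp: d_def intro: continuous_intros)
  next
    case (Suc k)
    have "\<bar>us (Suc k) x - us k x\<bar> \<le> q ^ k * d / (2 * (\<beta> + 1))"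
      by (rule radial_potential_diff_bound[OF beta phi_cont phi_cont us_deriv us_deriv])
         (use Suc us_1 in auto)
    then have "L * \<bar>us (Suc k) x - us k x\<bar> \<le> L * (q ^ k * d / (2 * (\<beta> + 1)))"
      using L_nonneg by (rule mult_left_mono)
    also have "\<dots> = q ^ Suc k * d" by (simp only: Lq power_Suc mult.assoc)
    finally have "L * \<bar>us (Suc k) x - us k x\<bar> \<le> q ^ Suc k * d" .
    moreover have "\<bar>f x (us (Suc k) x) - f x (us k x)\<bar> \<le> L * \<bar>us (Suc k) x - us k x\<bar>"
      using Suc.prems us_R by (intro f_lipschitz) (auto simp: dom_D_def)
    ultimately show ?case using phi_Suc[OF Suc.prems] by simp
  qed
  obtain \<Phi> where Phi: "\<And>k x. x \<in> ?I \<Longrightarrow> \<bar>\<phi> k x - \<Phi> x\<bar> \<le> q ^ k / (1 - q) * d"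
    using geometric_steps_limit[of q ?I \<phi> d, OF q0 q_less_1 step] by blast
  have p: "p k = q ^ k / (1 - q) * d" for k by (simp add: p_def d_def)
  have Phi_p: "\<bar>\<phi> k x - \<Phi> x\<bar> \<le> p k" if "x \<in> ?I" for k x using Phi[OF that] by (simp add: p)
  have Phi_lim: "uniform_limit ?I \<phi> \<Phi> sequentially"
    using Phi by (intro uniform_limit_geometric[OF q0 q_less_1, where c = "d / (1 - q)"])
                 (auto simp: mult.commute)
  have Phi_cont: "continuous_on ?I \<Phi>"
    using phi_cont by (intro uniform_limit_theorem[OF _ Phi_lim]) auto

  \<comment> \<open>The potential of the limit source is the solution; that \<open>\<Phi>\<close> is its source follows by
    letting \<open>k\<close> tend to infinity in \<open>\<phi> (k + 1) x = f x (us k x)\<close>.\<close>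
  define u where "u x = \<alpha> + green_potential \<beta> \<Phi> x" for x
  have u_deriv: "(u has_real_derivative radial_flux \<beta> \<Phi> x) (at x within ?I)" if "x \<in> ?I" for x
    unfolding u_def using pot_deriv[OF Phi_cont that] .
  have u_1: "u 1 = \<alpha>" unfolding u_def by (rule pot_1[OF Phi_cont])
  have us_u: "\<bar>us k x - u x\<bar> \<le> p k / (2 * (\<beta> + 1))" if "x \<in> ?I" for k x
    using Phi_p that us_1 u_1
    by (intro radial_potential_diff_bound[OF beta phi_cont Phi_cont us_deriv u_deriv]) auto
  have us_lim: "uniform_limit ?I us u sequentially"
    using us_u by (intro uniform_limit_geometric[OF q0 q_less_1,
                      where c = "d / (1 - q) / (2 * (\<beta> + 1))"]) (auto simp: p mult_ac)
  have Phi_M: "\<bar>\<Phi> x\<bar> \<le> M" if "x \<in> ?I" for x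
    using phi_M[OF that] tendsto_uniform_limitI[OF Phi_lim that]
    by (intro LIMSEQ_le_const2[of "\<lambda>k. \<bar>\<phi> k x\<bar>"] tendsto_intros) auto
  have u_R: "\<bar>u x\<bar> \<le> ?R" if "x \<in> ?I" for x
    unfolding u_def by (rule pot_bound[OF Phi_cont Phi_M that])
  have Phi_eq: "\<Phi> x = f x (u x)" if x: "x \<in> ?I" for x
  proof (rule LIMSEQ_unique)
    show "(\<lambda>k. \<phi> (Suc k) x) \<longlonglongrightarrow> \<Phi> x"
      using tendsto_uniform_limitI[OF Phi_lim x] by (rule LIMSEQ_Suc)
    have "continuous_on UNIV (f x)"
      using continuous_on_compose2[OF f_cont, of UNIV "\<lambda>y. (x, y)"] x
      by (simp add: continuous_on_Pair image_subset_iff)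
    then have "(\<lambda>k. f x (us k x)) \<longlonglongrightarrow> f x (u x)"
      using tendsto_uniform_limitI[OF us_lim x]
      by (intro continuous_on_tendsto_compose[of UNIV "f x"]) auto
    then show "(\<lambda>k. \<phi> (Suc k) x) \<longlonglongrightarrow> f x (u x)" by (simp add: phi_Suc[OF x])
  qed

  have sol: "bvp_solution \<alpha> \<beta> f u"
    by (rule bvp_solutionI[where f = f, OF beta Phi_cont u_deriv u_1 Phi_eq])
  have u': "deriv01 u x = radial_flux \<beta> \<Phi> x" if "x \<in> ?I" for x
    using deriv01_eqI[OF u_deriv] that by blast
  have us': "deriv01 (us k) x = radial_flux \<beta> (\<phi> k) x" if "x \<in> ?I" for k x
    using deriv01_eqI[OF us_deriv] that by blast
  have scale: "c / (\<beta> + 1) * x \<le> c / (\<beta> + 1)" if "c \<ge> 0" "x \<in> ?I" for c x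
    using that beta by (intro mult_left_le) auto

  have u'_M: "sup_norm (deriv01 u) \<le> M / (\<beta> + 1)"
  proof (rule sup_norm_le)
    fix x assume x: "x \<in> ?I"
    show "\<bar>deriv01 u x\<bar> \<le> M / (\<beta> + 1)"
      using radial_flux_bound[OF beta Phi_cont Phi_M x] scale[of M x] M_pos x by (simp add: u')
  qed
  have us'_u': "sup_norm (\<lambda>x. deriv01 (us k) x - deriv01 u x) \<le> 1 / (\<beta> + 1) * p k" for k
  proof (rule sup_norm_le)
    fix x assume x: "x \<in> ?I"
    have "p k \<ge> 0" using Phi_p[OF x, of k] by linarith
    then show "\<bar>deriv01 (us k) x - deriv01 u x\<bar> \<le> 1 / (\<beta> + 1) * p k"
      using radial_flux_diff_bound[OF beta phi_cont Phi_cont Phi_p x, of k] scale[of "p k" x] x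
      by (simp add: u' us')
  qed
  have unique: "v x = u x"
    if v: "bvp_solution \<alpha> \<beta> f v" "sup_norm v \<le> ?R" and x: "x \<in> ?I" for v x
  proof -
    let ?\<psi> = "\<lambda>t. f t (v t)"
    have v_deriv: "(v has_real_derivative radial_flux \<beta> ?\<psi> t) (at t within ?I)" if "t \<in> ?I" for t
      by (rule bvp_solution_has_derivative[OF beta v(1) that])
    have v_cont: "continuous_on ?I v" using v_deriv by (rule DERIV_continuous_on)
    have u_cont: "continuous_on ?I u" using u_deriv by (rule DERIV_continuous_on)
    have v_R: "\<bar>v t\<bar> \<le> ?R" if "t \<in> ?I" for t
      using abs_le_sup_norm[OF v_cont that] v(2) by linarith
    \<comment> \<open>The contraction gives \<open>e \<le> q * e\<close> for the distance \<open>e\<close> of two solutions, whence \<open>e \<le> 0\<close>.\<close>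
    define e where "e = sup_norm (\<lambda>t. v t - u t)"
    have e: "\<bar>v t - u t\<bar> \<le> e" if "t \<in> ?I" for t
      unfolding e_def using v_cont u_cont that
      by (intro abs_le_sup_norm[of "\<lambda>t. v t - u t"] continuous_intros)
    have "\<bar>?\<psi> t - \<Phi> t\<bar> \<le> L * e" if t: "t \<in> ?I" for t
    proof -
      have "\<bar>f t (v t) - f t (u t)\<bar> \<le> L * \<bar>v t - u t\<bar>"
        using t u_R v_R by (intro f_lipschitz) (auto simp: dom_D_def)
      also have "\<dots> \<le> L * e" using e[OF t] L_nonneg by (rule mult_left_mono)
      finally show ?thesis by (simp add: Phi_eq[OF t])
    qed
    then have "\<bar>v t - u t\<bar> \<le> L * e / (2 * (\<beta> + 1))" if "t \<in> ?I" for t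
      using v u_1 that
      by (intro radial_potential_diff_bound[OF beta f_comp[OF v_cont] Phi_cont v_deriv u_deriv])
         (auto simp: bvp_solution_def)
    then have "e \<le> q * e"
      unfolding e_def[symmetric] using sup_norm_le[of "\<lambda>t. v t - u t" "q * e"]
      by (auto simp: e_def q_def)
    then have "(1 - q) * e \<le> 0" by (simp add: algebra_simps)
    then have "e \<le> 0" using q_less_1 by (simp add: mult_le_0_iff)
    with e[OF x] show ?thesis by simp
  qed

  have "sup_norm u \<le> ?R" using u_R by (rule sup_norm_le)
  moreover have "sup_norm (\<lambda>x. us k x - u x) \<le> 1 / (2 * (\<beta> + 1)) * p k" for k
    using us_u by (intro sup_norm_le) auto
  moreover have "C1_on_01 (us k)" for k
    using us_deriv continuous_on_radial_flux[OF beta phi_cont] by (rule C1_on_01I)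
  ultimately show ?thesis using sol u'_M us'_u' unique us_lim by blast
qed

end
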